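(* Let $p\ge3$ be a prime, $q\ge1$ an integer, $\theta=p^N$ with $N<0$ (so $|\theta|_p>1$), and let $f(x)=\left(\frac{\theta x+q}{x+\theta+q-1}\right)^2$ have the three fixed points $x_0=1$, $x_1$, $x_2$ in $\mathbb{Q}_p$. Then: (i) $f(S_1(0))\subset S_1(0)$; (ii) $A(x_2)=B_1(0)$; (iii) $A(x_1)=\{x\in\mathbb{Q}_p:|x|_p>1\}\setminus\bigcup_{n=0}^\infty f^{-n}(1-\theta-q)$.
   Context: $|\cdot|_p$ is the $p$-adic absolute value. $x_1,x_2$ are the roots in $\mathbb{Q}_p$ of $x^2+(2\theta-\theta^2+2q-1)x+q^2=0$, labelled so that $|x_1|_p=|\theta|_p^2$ and $|x_2|_p=|q/\theta|_p^2$. $S_1(0)=\{x\in\mathbb{Q}_p:|x|_p=1\}$, $B_1(0)=\{x\in\mathbb{Q}_p:|x|_p<1\}$. $A(x_i)=\{y\in\mathbb{Q}_p:f^n(y)\to x_i,\ n\to\infty\}$ is the basin of attraction, with $f^n$ the $n$-fold iterate (all iterates required to be defined; $1-\theta-q$ is the pole of $f$). $f^{-n}(a)$ is the set of points $x\in\mathbb{Q}_p$ whose $n$-th iterate is defined and equals $a$ ($f^{-0}(a)=\{a\}$). *)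

theory Defs
  imports Complex_Main "Berlekamp_Zassenhaus.Finite_Field"
begin

section \<open>The p-adic absolute value on the rationals\<close>

definition rat_padic_abs :: "nat \<Rightarrow> rat \<Rightarrow> real" where
  "rat_padic_abs p x =
     (if x = 0 then 0
      else real p powi (int (multiplicity (int p) (snd (quotient_of x)))
                      - int (multiplicity (int p) (fst (quotient_of x)))))"

definition padic_cauchy :: "nat \<Rightarrow> (nat \<Rightarrow> rat) \<Rightarrow> bool" where
  "padic_cauchy p X \<longleftrightarrow> (\<forall>e>0. \<exists>M. \<forall>m\<ge>M. \<forall>n\<ge>M. rat_padic_abs p (X m - X n) < e)"

definition padic_null :: "nat \<Rightarrow> (nat \<Rightarrow> rat) \<Rightarrow> bool" where
  "padic_null p X \<longleftrightarrow> (\<lambda>n. rat_padic_abs p (X n)) \<longlonglongrightarrow> 0"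

context
  fixes p :: nat
  assumes p: "prime p"
begin

lemma rat_padic_abs_Fract:
  assumes "a \<noteq> 0" "b \<noteq> 0"
  shows "rat_padic_abs p (Rat.Fract a b) =
    real p powi (int (multiplicity (int p) b) - int (multiplicity (int p) a))"
proof -
  obtain c d where q: "quotient_of (Rat.Fract a b) = (c, d)" by (cases "quotient_of (Rat.Fract a b)")
  have d: "d > 0" using q by (rule quotient_of_denom_pos)
  have eq: "Rat.Fract a b = Rat.Fract c d"
    using quotient_of_div[OF q] by (simp add: Fract_of_int_quotient)
  hence cr: "a * d = c * b" using assms d by (simp add: eq_rat)
  have c: "c \<noteq> 0" using cr assms d by auto
  have pe: "prime_elem (int p)" using p by simp
  have "multiplicity (int p) (a * d) = multiplicity (int p) (c * b)" using cr by simp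
  hence "multiplicity (int p) a + multiplicity (int p) d
      = multiplicity (int p) c + multiplicity (int p) b"
    using assms c d pe by (simp add: prime_elem_multiplicity_mult_distrib)
  hence "int (multiplicity (int p) b) - int (multiplicity (int p) a)
      = int (multiplicity (int p) d) - int (multiplicity (int p) c)" by linarith
  moreover have "Rat.Fract a b \<noteq> 0" using assms by (simp add: Zero_rat_def eq_rat)
  ultimately show ?thesis unfolding rat_padic_abs_def using q by simp
qed

lemma rat_padic_abs_0 [simp]: "rat_padic_abs p 0 = 0"
  by (simp add: rat_padic_abs_def)

lemma rat_padic_abs_pos: "x \<noteq> 0 \<Longrightarrow> rat_padic_abs p x > 0"
  using prime_gt_0_nat[OF p] by (simp add: rat_padic_abs_def)

lemma rat_padic_abs_nonneg [simp]: "rat_padic_abs p x \<ge> 0"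
  by (cases "x = 0") (auto intro: less_imp_le rat_padic_abs_pos)

lemma rat_padic_abs_eq_0 [simp]: "rat_padic_abs p x = 0 \<longleftrightarrow> x = 0"
  using rat_padic_abs_pos[of x] by (cases "x = 0") auto

lemma rat_padic_abs_1 [simp]: "rat_padic_abs p 1 = 1"
  using rat_padic_abs_Fract[of 1 1] by (simp add: One_rat_def)

lemma rat_padic_abs_mult: "rat_padic_abs p (x * y) = rat_padic_abs p x * rat_padic_abs p y"
proof (cases "x = 0 \<or> y = 0")
  case False
  obtain a b where x: "x = Rat.Fract a b" "b > 0" by (cases x) auto
  obtain c d where y: "y = Rat.Fract c d" "d > 0" by (cases y) auto
  have a: "a \<noteq> 0" and c: "c \<noteq> 0" using False x y by (auto simp: rat_number_collapse)
  have pe: "prime_elem (int p)" using p by simp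
  have p0: "real p \<noteq> 0" using prime_gt_0_nat[OF p] by simp
  have "x * y = Rat.Fract (a * c) (b * d)" using x y by simp
  hence "rat_padic_abs p (x * y) =
      real p powi ((int (multiplicity (int p) b) - int (multiplicity (int p) a))
                 + (int (multiplicity (int p) d) - int (multiplicity (int p) c)))"
    using a c x y pe
    by (simp add: rat_padic_abs_Fract prime_elem_multiplicity_mult_distrib algebra_simps)
  thus ?thesis using a c x y p0 by (simp add: rat_padic_abs_Fract power_int_add)
qed auto

lemma rat_padic_abs_uminus [simp]: "rat_padic_abs p (- x) = rat_padic_abs p x"
proof -
  have "rat_padic_abs p (-1) * rat_padic_abs p (-1) = 1"
    using rat_padic_abs_mult[of "-1" "-1"] by simp
  hence "rat_padic_abs p (-1) = 1"
    using rat_padic_abs_nonneg[of "-1"] by (simp add: square_eq_1_iff)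
  thus ?thesis using rat_padic_abs_mult[of "-1" x] by simp
qed

lemma rat_padic_abs_minus_commute: "rat_padic_abs p (x - y) = rat_padic_abs p (y - x)"
  using rat_padic_abs_uminus[of "x - y"] by simp

lemma rat_padic_abs_add_le_max:
  "rat_padic_abs p (x + y) \<le> max (rat_padic_abs p x) (rat_padic_abs p y)"
proof (cases "x = 0 \<or> y = 0 \<or> x + y = 0")
  case True
  thus ?thesis by (auto simp: le_max_iff_disj)
next
  case False
  obtain a b where x: "x = Rat.Fract a b" "b > 0" by (cases x) auto
  obtain c d where y: "y = Rat.Fract c d" "d > 0" by (cases y) auto
  define m where "m = multiplicity (int p)"
  have x': "x = Rat.Fract (a * d) (b * d)" and y': "y = Rat.Fract (c * b) (b * d)"
    using x y by (auto simp: eq_rat)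
  have s': "x + y = Rat.Fract (a * d + c * b) (b * d)" using x y by simp
  have n: "a * d \<noteq> 0" "c * b \<noteq> 0" "a * d + c * b \<noteq> 0" "b * d \<noteq> 0"
    using False x y unfolding s' by (auto simp: rat_number_collapse)
  have nu: "\<not> is_unit (int p)" using prime_gt_1_nat[OF p] by simp
  have "int p ^ min (m (a * d)) (m (c * b)) dvd a * d + c * b"
    unfolding m_def by (intro dvd_add multiplicity_dvd') auto
  hence "min (m (a * d)) (m (c * b)) \<le> m (a * d + c * b)"
    unfolding m_def using n nu by (intro multiplicity_geI) auto
  hence le: "m (a * d) \<le> m (a * d + c * b) \<or> m (c * b) \<le> m (a * d + c * b)" by linarith
  have p1: "real p \<ge> 1" using prime_ge_1_nat[OF p] by simp
  have sub: "rat_padic_abs p (x + y) \<le> rat_padic_abs p (Rat.Fract e (b * d))"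
    if "e \<noteq> 0" "m e \<le> m (a * d + c * b)" for e
    unfolding s' using that n p1
    by (simp add: rat_padic_abs_Fract m_def power_int_increasing)
  show ?thesis using le sub[of "a * d"] sub[of "c * b"] n
    unfolding x'[symmetric] y'[symmetric] by (auto simp: le_max_iff_disj)
qed

lemma rat_padic_abs_add_le: "rat_padic_abs p (x + y) \<le> rat_padic_abs p x + rat_padic_abs p y"
  using rat_padic_abs_add_le_max[of x y] rat_padic_abs_nonneg[of x] rat_padic_abs_nonneg[of y]
  by linarith

lemma rat_padic_abs_diff_le: "rat_padic_abs p (x - y) \<le> rat_padic_abs p x + rat_padic_abs p y"
  using rat_padic_abs_add_le[of x "- y"] by simp

lemma rat_padic_abs_triangle3: "\<bar>rat_padic_abs p x - rat_padic_abs p y\<bar> \<le> rat_padic_abs p (x - y)"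
  using rat_padic_abs_add_le[of "x - y" y] rat_padic_abs_add_le[of "y - x" x]
    rat_padic_abs_minus_commute[of x y] by simp

lemma rat_padic_abs_inverse: "rat_padic_abs p (inverse x) = inverse (rat_padic_abs p x)"
proof (cases "x = 0")
  case False
  have "rat_padic_abs p (inverse x) * rat_padic_abs p x = 1"
    using False rat_padic_abs_mult[of "inverse x" x] by simp
  thus ?thesis by (metis inverse_unique mult.commute)
qed auto

subsection \<open>Cauchy and null sequences\<close>

lemma padic_cauchyD:
  "padic_cauchy p X \<Longrightarrow> e > 0 \<Longrightarrow> \<exists>M. \<forall>m\<ge>M. \<forall>n\<ge>M. rat_padic_abs p (X m - X n) < e"
  by (simp add: padic_cauchy_def)

lemma padic_cauchy_const [simp]: "padic_cauchy p (\<lambda>_. c)"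
  by (auto simp: padic_cauchy_def)

lemma padic_cauchy_abs_convergent:
  assumes "padic_cauchy p X"
  shows "convergent (\<lambda>n. rat_padic_abs p (X n))"
proof -
  have "Cauchy (\<lambda>n. rat_padic_abs p (X n))"
  proof (rule metric_CauchyI)
    fix e :: real assume "e > 0"
    then obtain M where M: "\<forall>m\<ge>M. \<forall>n\<ge>M. rat_padic_abs p (X m - X n) < e"
      using padic_cauchyD[OF assms] by blast
    show "\<exists>M. \<forall>m\<ge>M. \<forall>n\<ge>M. dist (rat_padic_abs p (X m)) (rat_padic_abs p (X n)) < e"
      using M rat_padic_abs_triangle3 by (metis dist_real_def le_less_trans)
  qed
  thus ?thesis by (simp add: Cauchy_convergent_iff)
qed

lemma padic_cauchy_bound:
  assumes "padic_cauchy p X"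
  obtains B where "B > 0" "\<And>n. rat_padic_abs p (X n) \<le> B"
  using convergent_imp_Bseq[OF padic_cauchy_abs_convergent[OF assms]]
  unfolding Bseq_def by auto

lemma padic_cauchy_add:
  assumes "padic_cauchy p X" "padic_cauchy p Y"
  shows "padic_cauchy p (\<lambda>n. X n + Y n)"
  unfolding padic_cauchy_def
proof (intro allI impI)
  fix e :: real assume e: "e > 0"
  obtain M where M: "\<forall>m\<ge>M. \<forall>n\<ge>M. rat_padic_abs p (X m - X n) < e"
    using padic_cauchyD[OF assms(1) e] by blast
  obtain N where N: "\<forall>m\<ge>N. \<forall>n\<ge>N. rat_padic_abs p (Y m - Y n) < e"
    using padic_cauchyD[OF assms(2) e] by blast
  have "rat_padic_abs p (X m + Y m - (X n + Y n)) < e" if "m \<ge> max M N" "n \<ge> max M N" for m n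
  proof -
    have "rat_padic_abs p (X m + Y m - (X n + Y n)) = rat_padic_abs p ((X m - X n) + (Y m - Y n))"
      by (simp add: algebra_simps)
    also have "\<dots> \<le> max (rat_padic_abs p (X m - X n)) (rat_padic_abs p (Y m - Y n))"
      by (rule rat_padic_abs_add_le_max)
    also have "\<dots> < e" using M N that by auto
    finally show ?thesis .
  qed
  thus "\<exists>M. \<forall>m\<ge>M. \<forall>n\<ge>M. rat_padic_abs p (X m + Y m - (X n + Y n)) < e" by blast
qed

lemma padic_cauchy_uminus:
  assumes "padic_cauchy p X"
  shows "padic_cauchy p (\<lambda>n. - X n)"
proof -
  have "- X m - - X n = - (X m - X n)" for m n by simp
  thus ?thesis using assms unfolding padic_cauchy_def by (simp only: rat_padic_abs_uminus)
qed

lemma padic_cauchy_diff: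
  assumes "padic_cauchy p X" "padic_cauchy p Y"
  shows "padic_cauchy p (\<lambda>n. X n - Y n)"
  using padic_cauchy_add[OF assms(1) padic_cauchy_uminus[OF assms(2)]] by simp

lemma padic_cauchy_mult:
  assumes "padic_cauchy p X" "padic_cauchy p Y"
  shows "padic_cauchy p (\<lambda>n. X n * Y n)"
  unfolding padic_cauchy_def
proof (intro allI impI)
  fix e :: real assume e: "e > 0"
  obtain A where A: "A > 0" "\<And>n. rat_padic_abs p (X n) \<le> A"
    using padic_cauchy_bound[OF assms(1)] by blast
  obtain B where B: "B > 0" "\<And>n. rat_padic_abs p (Y n) \<le> B"
    using padic_cauchy_bound[OF assms(2)] by blast
  obtain M where M: "\<forall>m\<ge>M. \<forall>n\<ge>M. rat_padic_abs p (X m - X n) < e / B"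
    using padic_cauchyD[OF assms(1), of "e / B"] e B by auto
  obtain N where N: "\<forall>m\<ge>N. \<forall>n\<ge>N. rat_padic_abs p (Y m - Y n) < e / A"
    using padic_cauchyD[OF assms(2), of "e / A"] e A by auto
  have "rat_padic_abs p (X m * Y m - X n * Y n) < e" if mn: "m \<ge> max M N" "n \<ge> max M N" for m n
  proof -
    have 1: "rat_padic_abs p (X m * (Y m - Y n)) < e"
    proof -
      have "rat_padic_abs p (X m * (Y m - Y n)) \<le> A * rat_padic_abs p (Y m - Y n)"
        using A(2) by (simp add: rat_padic_abs_mult mult_right_mono)
      also have "\<dots> < A * (e / A)" using A mn N by (intro mult_strict_left_mono) auto
      finally show ?thesis using A by simp
    qed
    have 2: "rat_padic_abs p ((X m - X n) * Y n) < e"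
    proof -
      have "rat_padic_abs p ((X m - X n) * Y n) \<le> rat_padic_abs p (X m - X n) * B"
        using B(2) by (simp add: rat_padic_abs_mult mult_left_mono)
      also have "\<dots> < (e / B) * B" using B mn M by (intro mult_strict_right_mono) auto
      finally show ?thesis using B by simp
    qed
    have "rat_padic_abs p (X m * Y m - X n * Y n)
        = rat_padic_abs p (X m * (Y m - Y n) + (X m - X n) * Y n)"
      by (simp add: algebra_simps)
    also have "\<dots> \<le> max (rat_padic_abs p (X m * (Y m - Y n))) (rat_padic_abs p ((X m - X n) * Y n))"
      by (rule rat_padic_abs_add_le_max)
    also have "\<dots> < e" using 1 2 by simp
    finally show ?thesis .
  qed
  thus "\<exists>M. \<forall>m\<ge>M. \<forall>n\<ge>M. rat_padic_abs p (X m * Y m - X n * Y n) < e" by blast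
qed

lemma padic_null_const_0 [simp]: "padic_null p (\<lambda>_. 0)"
  by (simp add: padic_null_def)

lemma padic_null_eventually_0: "eventually (\<lambda>n. X n = 0) sequentially \<Longrightarrow> padic_null p X"
  unfolding padic_null_def by (rule tendsto_eventually) (auto elim: eventually_mono)

lemma padic_null_add:
  assumes "padic_null p X" "padic_null p Y"
  shows "padic_null p (\<lambda>n. X n + Y n)"
  unfolding padic_null_def
proof (rule tendsto_sandwich[of "\<lambda>_. 0"])
  show "(\<lambda>n. rat_padic_abs p (X n) + rat_padic_abs p (Y n)) \<longlonglongrightarrow> 0"
    using tendsto_add[OF assms[unfolded padic_null_def]] by simp
qed (auto intro!: always_eventually rat_padic_abs_add_le)

lemma padic_null_uminus: "padic_null p X \<Longrightarrow> padic_null p (\<lambda>n. - X n)"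
  by (simp add: padic_null_def)

lemma padic_null_mult:
  assumes "padic_null p X" "padic_cauchy p Y"
  shows "padic_null p (\<lambda>n. X n * Y n)"
proof -
  obtain L where "(\<lambda>n. rat_padic_abs p (Y n)) \<longlonglongrightarrow> L"
    using padic_cauchy_abs_convergent[OF assms(2)] by (auto simp: convergent_def)
  thus ?thesis using tendsto_mult[OF assms(1)[unfolded padic_null_def]]
    by (fastforce simp: padic_null_def rat_padic_abs_mult)
qed

lemma padic_cauchy_nonnull:
  assumes "padic_cauchy p X" "\<not> padic_null p X"
  obtains c where "c > 0" "eventually (\<lambda>n. rat_padic_abs p (X n) > c) sequentially"
proof -
  obtain L where L: "(\<lambda>n. rat_padic_abs p (X n)) \<longlonglongrightarrow> L"
    using padic_cauchy_abs_convergent[OF assms(1)] by (auto simp: convergent_def)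
  have "L \<ge> 0" using L by (rule LIMSEQ_le_const) auto
  moreover have "L \<noteq> 0" using L assms(2) by (auto simp: padic_null_def)
  ultimately have "L / 2 > 0" "L / 2 < L" by auto
  with that[of "L / 2"] order_tendstoD(1)[OF L, of "L / 2"] show thesis by blast
qed

lemma padic_cauchy_inverse:
  assumes "padic_cauchy p X" "\<not> padic_null p X"
  shows "padic_cauchy p (\<lambda>n. inverse (X n))"
  unfolding padic_cauchy_def
proof (intro allI impI)
  fix e :: real assume e: "e > 0"
  obtain c where c: "c > 0" "eventually (\<lambda>n. rat_padic_abs p (X n) > c) sequentially"
    using padic_cauchy_nonnull[OF assms] by blast
  obtain N where N: "\<forall>n\<ge>N. rat_padic_abs p (X n) > c"
    using c(2) by (auto simp: eventually_sequentially)
  obtain M where M: "\<forall>m\<ge>M. \<forall>n\<ge>M. rat_padic_abs p (X m - X n) < e * (c * c)"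
    using padic_cauchyD[OF assms(1), of "e * (c * c)"] e c by auto
  have "rat_padic_abs p (inverse (X m) - inverse (X n)) < e"
    if mn: "m \<ge> max M N" "n \<ge> max M N" for m n
  proof -
    have gt: "rat_padic_abs p (X m) > c" "rat_padic_abs p (X n) > c" using mn N by auto
    hence nz: "X m \<noteq> 0" "X n \<noteq> 0" using c(1) by auto
    have "(X m - X n) = - ((inverse (X m) - inverse (X n)) * (X m * X n))"
      using nz by (simp add: field_simps)
    hence eq: "rat_padic_abs p (X m - X n)
        = rat_padic_abs p (inverse (X m) - inverse (X n)) * (rat_padic_abs p (X m) * rat_padic_abs p (X n))"
      by (metis rat_padic_abs_uminus rat_padic_abs_mult)
    have "rat_padic_abs p (inverse (X m) - inverse (X n)) * (c * c) \<le> rat_padic_abs p (X m - X n)"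
      unfolding eq using gt c(1) by (intro mult_left_mono mult_mono) auto
    also have "\<dots> < e * (c * c)" using M mn by auto
    finally show ?thesis using c(1) by (simp add: mult_less_cancel_right)
  qed
  thus "\<exists>M. \<forall>m\<ge>M. \<forall>n\<ge>M. rat_padic_abs p (inverse (X m) - inverse (X n)) < e" by blast
qed

end

section \<open>The field of p-adic numbers\<close>

text \<open>
  The prime \<open>p\<close> is the cardinality of the index type \<open>'p\<close>.  The type \<open>'p padic\<close> is the completion
  of the rationals with respect to the p-adic absolute value: Cauchy sequences modulo null sequences.
\<close>

lemma prime_CARD: "prime CARD('p::prime_card)"
  by (rule prime_card)

typedef (overloaded) ('p::prime_card) padic_seq = "{X. padic_cauchy CARD('p) X}"
  by (rule exI[of _ "\<lambda>_. 0"]) (simp add: padic_cauchy_const[OF prime_CARD])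

setup_lifting type_definition_padic_seq

lift_definition pseq_null :: "'p::prime_card padic_seq \<Rightarrow> bool" is "padic_null CARD('p)" .

lift_definition pseq_const :: "rat \<Rightarrow> 'p::prime_card padic_seq" is "\<lambda>c _. c"
  by (rule padic_cauchy_const[OF prime_CARD])

lift_definition pseq_add :: "'p::prime_card padic_seq \<Rightarrow> 'p padic_seq \<Rightarrow> 'p padic_seq"
  is "\<lambda>X Y n. X n + Y n" by (rule padic_cauchy_add[OF prime_CARD])

lift_definition pseq_uminus :: "'p::prime_card padic_seq \<Rightarrow> 'p padic_seq"
  is "\<lambda>X n. - X n" by (rule padic_cauchy_uminus[OF prime_CARD])

lift_definition pseq_diff :: "'p::prime_card padic_seq \<Rightarrow> 'p padic_seq \<Rightarrow> 'p padic_seq"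
  is "\<lambda>X Y n. X n - Y n" by (rule padic_cauchy_diff[OF prime_CARD])

lift_definition pseq_mult :: "'p::prime_card padic_seq \<Rightarrow> 'p padic_seq \<Rightarrow> 'p padic_seq"
  is "\<lambda>X Y n. X n * Y n" by (rule padic_cauchy_mult[OF prime_CARD])

lift_definition pseq_inverse :: "'p::prime_card padic_seq \<Rightarrow> 'p padic_seq"
  is "\<lambda>X. if padic_null CARD('p) X then (\<lambda>_. 0) else (\<lambda>n. inverse (X n))"
  by (simp add: padic_cauchy_const[OF prime_CARD] padic_cauchy_inverse[OF prime_CARD])

lift_definition pseq_abs :: "'p::prime_card padic_seq \<Rightarrow> real"
  is "\<lambda>X. lim (\<lambda>n. rat_padic_abs CARD('p) (X n))" .

definition pseq_rel :: "'p::prime_card padic_seq \<Rightarrow> 'p padic_seq \<Rightarrow> bool" where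
  "pseq_rel X Y \<longleftrightarrow> pseq_null (pseq_diff X Y)"

lemma pseq_nullI:
  "(\<And>n. Rep_padic_seq X n = 0) \<Longrightarrow> pseq_null X"
  by transfer (simp add: padic_null_eventually_0[OF prime_CARD])

lemma pseq_null_add: "pseq_null X \<Longrightarrow> pseq_null Y \<Longrightarrow> pseq_null (pseq_add X Y)"
  by transfer (rule padic_null_add[OF prime_CARD])

lemma pseq_null_uminus: "pseq_null X \<Longrightarrow> pseq_null (pseq_uminus X)"
  by transfer (rule padic_null_uminus[OF prime_CARD])

lemma pseq_null_mult: "pseq_null X \<Longrightarrow> pseq_null (pseq_mult X Y)"
  by transfer (rule padic_null_mult[OF prime_CARD])

lemma pseq_rel_refl: "pseq_rel X X"
  unfolding pseq_rel_def by (rule pseq_nullI) (simp add: pseq_diff.rep_eq)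

lemma pseq_rel_sym: "pseq_rel X Y \<Longrightarrow> pseq_rel Y X"
proof -
  have "pseq_diff Y X = pseq_uminus (pseq_diff X Y)" by transfer simp
  thus "pseq_rel X Y \<Longrightarrow> pseq_rel Y X" by (simp add: pseq_rel_def pseq_null_uminus)
qed

lemma pseq_rel_trans: "pseq_rel X Y \<Longrightarrow> pseq_rel Y Z \<Longrightarrow> pseq_rel X Z"
proof -
  have "pseq_diff X Z = pseq_add (pseq_diff X Y) (pseq_diff Y Z)" by transfer simp
  thus "pseq_rel X Y \<Longrightarrow> pseq_rel Y Z \<Longrightarrow> pseq_rel X Z" by (simp add: pseq_rel_def pseq_null_add)
qed

lemma pseq_rel_add:
  assumes "pseq_rel X X'" "pseq_rel Y Y'"
  shows "pseq_rel (pseq_add X Y) (pseq_add X' Y')"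
proof -
  have "pseq_diff (pseq_add X Y) (pseq_add X' Y') = pseq_add (pseq_diff X X') (pseq_diff Y Y')"
    by transfer (simp add: algebra_simps)
  thus ?thesis using assms by (simp add: pseq_rel_def pseq_null_add)
qed

lemma pseq_rel_uminus:
  assumes "pseq_rel X X'"
  shows "pseq_rel (pseq_uminus X) (pseq_uminus X')"
proof -
  have "pseq_diff (pseq_uminus X) (pseq_uminus X') = pseq_uminus (pseq_diff X X')"
    by transfer simp
  thus ?thesis using assms by (simp add: pseq_rel_def pseq_null_uminus)
qed

lemma pseq_rel_mult:
  assumes "pseq_rel X X'" "pseq_rel Y Y'"
  shows "pseq_rel (pseq_mult X Y) (pseq_mult X' Y')"
proof -
  have "pseq_diff (pseq_mult X Y) (pseq_mult X' Y')
      = pseq_add (pseq_mult (pseq_diff X X') Y) (pseq_mult (pseq_diff Y Y') X')"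
    by transfer (simp add: algebra_simps)
  thus ?thesis using assms by (simp add: pseq_rel_def pseq_null_add pseq_null_mult)
qed

lemma pseq_null_rel:
  assumes "pseq_rel X Y"
  shows "pseq_null X \<longleftrightarrow> pseq_null Y"
proof -
  have 1: "X = pseq_add (pseq_diff X Y) Y" "Y = pseq_add (pseq_diff Y X) X"
    by (transfer, simp)+
  show ?thesis
    using assms pseq_rel_sym[OF assms] unfolding pseq_rel_def by (metis 1 pseq_null_add)
qed

lemma pseq_inverse_left:
  assumes "\<not> pseq_null X"
  shows "pseq_rel (pseq_mult (pseq_inverse X) X) (pseq_const 1)"
  using assms unfolding pseq_rel_def
proof transfer
  fix X :: "nat \<Rightarrow> rat" assume X: "padic_cauchy CARD('a) X" "\<not> padic_null CARD('a) X"
  obtain c where c: "c > 0" "eventually (\<lambda>n. rat_padic_abs CARD('a) (X n) > c) sequentially"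
    using padic_cauchy_nonnull[OF prime_CARD X] by blast
  have "eventually (\<lambda>n. inverse (X n) * X n - 1 = 0) sequentially"
    using c(2)
  proof eventually_elim
    case (elim n)
    hence "X n \<noteq> 0" using c(1) rat_padic_abs_0[OF prime_CARD] by (metis less_asym)
    thus ?case by simp
  qed
  thus "padic_null CARD('a)
      (\<lambda>n. (if padic_null CARD('a) X then \<lambda>_. 0 else (\<lambda>n. inverse (X n))) n * X n - 1)"
    using X(2) by (simp add: padic_null_eventually_0[OF prime_CARD])
qed

lemma pseq_rel_inverse:
  assumes "pseq_rel X Y"
  shows "pseq_rel (pseq_inverse X) (pseq_inverse Y)"
proof (cases "pseq_null X")
  case True
  hence "pseq_null Y" using pseq_null_rel[OF assms] by simp
  hence "pseq_inverse X = pseq_const 0" "pseq_inverse Y = pseq_const 0"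
    using True by (transfer, simp)+
  thus ?thesis by (simp add: pseq_rel_refl)
next
  case False
  hence Y: "\<not> pseq_null Y" using pseq_null_rel[OF assms] by simp
  let ?i = "pseq_inverse X" and ?j = "pseq_inverse Y"
  have c: "pseq_mult A B = pseq_mult B A"
    and a: "pseq_mult (pseq_mult A B) C = pseq_mult A (pseq_mult B C)"
    and u: "pseq_mult A (pseq_const 1) = A" for A B C :: "'a padic_seq"
    by (transfer, simp add: ac_simps)+
  have "pseq_rel (pseq_mult ?i (pseq_mult ?j Y)) (pseq_mult ?i (pseq_const 1))"
    by (intro pseq_rel_mult pseq_rel_refl pseq_inverse_left Y)
  hence 1: "pseq_rel (pseq_mult ?i (pseq_mult ?j Y)) ?i" by (simp add: u)
  have "pseq_rel (pseq_mult ?j (pseq_mult ?i X)) (pseq_mult ?j (pseq_const 1))"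
    by (intro pseq_rel_mult pseq_rel_refl pseq_inverse_left False)
  hence 2: "pseq_rel (pseq_mult ?j (pseq_mult ?i X)) ?j" by (simp add: u)
  have 3: "pseq_rel (pseq_mult ?i (pseq_mult ?j X)) (pseq_mult ?i (pseq_mult ?j Y))"
    by (intro pseq_rel_mult pseq_rel_refl assms)
  have 4: "pseq_mult ?j (pseq_mult ?i X) = pseq_mult ?i (pseq_mult ?j X)"
    by (metis a c)
  show ?thesis using 1 2 3 4 by (metis pseq_rel_sym pseq_rel_trans)
qed

lemma pseq_abs_tendsto:
  "(\<lambda>n. rat_padic_abs CARD('p) (Rep_padic_seq X n)) \<longlonglongrightarrow> pseq_abs (X :: 'p::prime_card padic_seq)"
proof -
  have "padic_cauchy CARD('p) (Rep_padic_seq X)" using Rep_padic_seq[of X] by simp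
  from padic_cauchy_abs_convergent[OF prime_CARD this] show ?thesis
    by (simp add: convergent_LIMSEQ_iff pseq_abs.rep_eq)
qed

lemma pseq_abs_eqI:
  "(\<lambda>n. rat_padic_abs CARD('p) (Rep_padic_seq X n)) \<longlonglongrightarrow> c \<Longrightarrow> pseq_abs (X :: 'p::prime_card padic_seq) = c"
  using LIMSEQ_unique[OF pseq_abs_tendsto] by blast

lemma pseq_abs_eq_0: "pseq_abs X = 0 \<longleftrightarrow> pseq_null X"
  using pseq_abs_tendsto[of X] pseq_abs_eqI[of X 0]
  by (auto simp: pseq_null.rep_eq padic_null_def)

lemma pseq_abs_nonneg: "pseq_abs X \<ge> 0"
  by (rule LIMSEQ_le_const[OF pseq_abs_tendsto]) (simp add: rat_padic_abs_nonneg[OF prime_CARD])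

lemma pseq_abs_const: "pseq_abs (pseq_const c :: 'p::prime_card padic_seq) = rat_padic_abs CARD('p) c"
  by (rule pseq_abs_eqI) (simp add: pseq_const.rep_eq)

lemma pseq_abs_mult: "pseq_abs (pseq_mult X Y) = pseq_abs X * pseq_abs Y"
  by (rule pseq_abs_eqI)
     (simp add: pseq_mult.rep_eq rat_padic_abs_mult[OF prime_CARD] tendsto_mult pseq_abs_tendsto)

lemma pseq_abs_uminus: "pseq_abs (pseq_uminus X) = pseq_abs X"
  by (rule pseq_abs_eqI)
     (simp add: pseq_uminus.rep_eq rat_padic_abs_uminus[OF prime_CARD] pseq_abs_tendsto)

lemma pseq_abs_add: "pseq_abs (pseq_add X Y) \<le> max (pseq_abs X) (pseq_abs Y)"
proof (rule LIMSEQ_le[OF pseq_abs_tendsto])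
  show "(\<lambda>n. max (rat_padic_abs CARD('a) (Rep_padic_seq X n))
          (rat_padic_abs CARD('a) (Rep_padic_seq Y n))) \<longlonglongrightarrow> max (pseq_abs X) (pseq_abs Y)"
    by (intro tendsto_max pseq_abs_tendsto)
qed (use rat_padic_abs_add_le_max[OF prime_CARD] in \<open>auto simp: pseq_add.rep_eq\<close>)

lemma pseq_abs_rel:
  assumes "pseq_rel X Y"
  shows "pseq_abs X = pseq_abs Y"
proof -
  have le: "pseq_abs A \<le> pseq_abs B" if "pseq_rel A B" for A B :: "'a padic_seq"
  proof -
    have "A = pseq_add (pseq_diff A B) B" by transfer simp
    moreover have "pseq_abs (pseq_diff A B) = 0"
      using that by (simp add: pseq_rel_def pseq_abs_eq_0)
    ultimately show ?thesis
      using pseq_abs_add[of "pseq_diff A B" B] pseq_abs_nonneg[of B] by simp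
  qed
  show ?thesis using le[OF assms] le[OF pseq_rel_sym[OF assms]] by simp
qed

quotient_type (overloaded) 'p padic = "('p::prime_card) padic_seq" / pseq_rel
  by (intro equivpI reflpI sympI transpI)
     (blast intro: pseq_rel_refl pseq_rel_sym pseq_rel_trans)+

instantiation padic :: (prime_card) field
begin

lift_definition zero_padic :: "'a padic" is "pseq_const 0" .
lift_definition one_padic :: "'a padic" is "pseq_const 1" .
lift_definition plus_padic :: "'a padic \<Rightarrow> 'a padic \<Rightarrow> 'a padic" is pseq_add
  by (rule pseq_rel_add)
lift_definition uminus_padic :: "'a padic \<Rightarrow> 'a padic" is pseq_uminus
  by (rule pseq_rel_uminus)
lift_definition times_padic :: "'a padic \<Rightarrow> 'a padic \<Rightarrow> 'a padic" is pseq_mult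
  by (rule pseq_rel_mult)
lift_definition inverse_padic :: "'a padic \<Rightarrow> 'a padic" is pseq_inverse
  by (rule pseq_rel_inverse)

definition "x - y = x + - y" for x y :: "'a padic"
definition "x div y = x * inverse y" for x y :: "'a padic"

instance
proof
  have eq: "pseq_rel X Y" if "X = Y" for X Y :: "'a padic_seq"
    using that by (simp add: pseq_rel_refl)
  fix a b c :: "'a padic"
  show "a + b = b + a"
    by transfer (rule eq, transfer, simp add: ac_simps)
  show "(a + b) + c = a + (b + c)"
    by transfer (rule eq, transfer, simp add: ac_simps)
  show "0 + a = a"
    by transfer (rule eq, transfer, simp)
  show "- a + a = 0"
    by transfer (rule eq, transfer, simp)
  show "a - b = a + - b"
    by (rule minus_padic_def)
  show "(a * b) * c = a * (b * c)"
    by transfer (rule eq, transfer, simp add: ac_simps)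
  show "a * b = b * a"
    by transfer (rule eq, transfer, simp add: ac_simps)
  show "1 * a = a"
    by transfer (rule eq, transfer, simp)
  show "(a + b) * c = a * c + b * c"
    by transfer (rule eq, transfer, simp add: distrib_right)
  show "(0::'a padic) \<noteq> 1"
  proof transfer
    show "\<not> pseq_rel (pseq_const 0) (pseq_const 1 :: 'a padic_seq)"
      using pseq_abs_rel[of "pseq_const 0" "pseq_const 1 :: 'a padic_seq"]
      by (auto simp: pseq_abs_const rat_padic_abs_0[OF prime_CARD] rat_padic_abs_1[OF prime_CARD])
  qed
  show "a \<noteq> 0 \<Longrightarrow> inverse a * a = 1"
  proof transfer
    fix X :: "'a padic_seq" assume X: "\<not> pseq_rel X (pseq_const 0)"
    have "pseq_diff X (pseq_const 0) = X" by transfer simp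
    with X show "pseq_rel (pseq_mult (pseq_inverse X) X) (pseq_const 1)"
      by (intro pseq_inverse_left) (simp add: pseq_rel_def)
  qed
  show "a div b = a * inverse b"
    by (rule divide_padic_def)
  show "inverse (0::'a padic) = 0"
    by transfer (rule eq, transfer, simp add: padic_null_const_0[OF prime_CARD])
qed

end

text \<open>The p-adic absolute value, extended from the rationals by continuity.\<close>

lift_definition padic_abs :: "'p::prime_card padic \<Rightarrow> real" is pseq_abs
  by (rule pseq_abs_rel)

lemma padic_abs_nonneg [simp]: "padic_abs x \<ge> 0"
  by transfer (rule pseq_abs_nonneg)

lemma padic_abs_eq_0 [simp]: "padic_abs x = 0 \<longleftrightarrow> x = 0"
proof transfer
  fix X :: "'a padic_seq"
  have "pseq_diff X (pseq_const 0) = X" by transfer simp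
  thus "pseq_abs X = 0 \<longleftrightarrow> pseq_rel X (pseq_const 0)" by (simp add: pseq_rel_def pseq_abs_eq_0)
qed

lemma padic_abs_0 [simp]: "padic_abs 0 = 0"
  by simp

lemma padic_abs_mult: "padic_abs (x * y) = padic_abs x * padic_abs y"
  by transfer (rule pseq_abs_mult)

lemma padic_abs_uminus [simp]: "padic_abs (- x) = padic_abs x"
  by transfer (rule pseq_abs_uminus)

lemma padic_abs_add_le_max: "padic_abs (x + y) \<le> max (padic_abs x) (padic_abs y)"
  by transfer (rule pseq_abs_add)

lemma of_nat_padic: "(of_nat n :: 'p::prime_card padic) = abs_padic (pseq_const (of_nat n))"
proof (induction n)
  case 0
  show ?case by (simp add: zero_padic_def)
next
  case (Suc n)
  have "pseq_add (pseq_const 1) (pseq_const (of_nat n)) = (pseq_const (of_nat (Suc n)) :: 'p padic_seq)"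
    by transfer simp
  thus ?case using Suc by (simp add: one_padic_def plus_padic.abs_eq)
qed

lemma padic_abs_of_nat: "padic_abs (of_nat n :: 'p::prime_card padic) = rat_padic_abs CARD('p) (of_nat n)"
  by (simp add: of_nat_padic padic_abs.abs_eq pseq_abs_const)

instance padic :: (prime_card) field_char_0
proof
  show "inj (of_nat :: nat \<Rightarrow> 'a padic)"
  proof (rule injI)
    have pos: "(of_nat k :: 'a padic) \<noteq> 0" if "k > 0" for k
      using that padic_abs_of_nat[of k, where 'p = 'a] rat_padic_abs_pos[OF prime_CARD[where 'p = 'a], of "of_nat k"]
      by force
    fix m n assume eq: "(of_nat m :: 'a padic) = of_nat n"
    show "m = n"
    proof (rule ccontr)
      assume "m \<noteq> n"
      then consider "m < n" | "n < m" by linarith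
      thus False
        by cases (use pos[of "n - m"] pos[of "m - n"] eq in \<open>simp_all add: of_nat_diff\<close>)
    qed
  qed
qed

lemma padic_abs_1 [simp]: "padic_abs 1 = 1"
  using padic_abs_of_nat[of 1] by (simp add: rat_padic_abs_1[OF prime_CARD])

lemma padic_abs_inverse: "padic_abs (inverse x) = inverse (padic_abs x)"
proof (cases "x = 0")
  case False
  have "padic_abs (inverse x) * padic_abs x = 1"
    using False padic_abs_mult[of "inverse x" x] by simp
  thus ?thesis by (metis inverse_unique mult.commute)
qed auto

lemma of_int_padic: "(of_int n :: 'p::prime_card padic) = abs_padic (pseq_const (of_int n))"
proof (cases n)
  case (nonneg k)
  thus ?thesis by (simp add: of_nat_padic)
next
  case (neg k)
  have "pseq_uminus (pseq_const (of_nat (Suc k))) = (pseq_const (of_int n) :: 'p padic_seq)"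
    unfolding neg by transfer simp
  thus ?thesis unfolding neg
    by (metis of_int_minus of_int_of_nat_eq of_nat_padic uminus_padic.abs_eq)
qed

lemma padic_abs_of_int: "padic_abs (of_int n :: 'p::prime_card padic) = rat_padic_abs CARD('p) (of_int n)"
  by (simp add: of_int_padic padic_abs.abs_eq pseq_abs_const)

lemma padic_abs_of_rat: "padic_abs (of_rat r :: 'p::prime_card padic) = rat_padic_abs CARD('p) r"
proof -
  obtain a b where "quotient_of r = (a, b)" by (cases "quotient_of r")
  hence r: "r = of_int a / of_int b" by (rule quotient_of_div)
  show ?thesis unfolding r
    by (simp add: of_rat_mult of_rat_inverse divide_inverse padic_abs_mult padic_abs_inverse padic_abs_of_int
        rat_padic_abs_mult[OF prime_CARD] rat_padic_abs_inverse[OF prime_CARD])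
qed

lemma padic_abs_CARD: "padic_abs (of_nat CARD('p) :: 'p::prime_card padic) = 1 / real CARD('p)"
proof -
  have m: "multiplicity (int CARD('p)) (int CARD('p)) = 1"
    using prime_CARD[where 'p = 'p] by (intro multiplicity_self) auto
  have "rat_padic_abs CARD('p) (Rat.Fract (int CARD('p)) 1) = 1 / real CARD('p)"
    by (subst rat_padic_abs_Fract[OF prime_CARD]) (use m in \<open>simp_all add: power_int_minus_divide\<close>)
  moreover have "Rat.Fract (int CARD('p)) 1 = of_nat CARD('p)" by (simp add: of_nat_rat)
  ultimately show ?thesis by (simp add: padic_abs_of_nat)
qed

instantiation padic :: (prime_card) metric_space
begin

definition dist_padic_def: "dist x y = padic_abs (x - y)" for x y :: "'a padic"

definition uniformity_padic_def [code del]: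
  "(uniformity :: ('a padic \<times> 'a padic) filter) = (INF e\<in>{0 <..}. principal {(x, y). dist x y < e})"

definition open_padic_def [code del]:
  "open (U :: 'a padic set) \<longleftrightarrow> (\<forall>x\<in>U. eventually (\<lambda>(x', y). x' = x \<longrightarrow> y \<in> U) uniformity)"

instance
proof
  fix x y z :: "'a padic"
  show "dist x y = 0 \<longleftrightarrow> x = y" by (simp add: dist_padic_def)
  have "padic_abs (x - y) \<le> max (padic_abs (x - z)) (padic_abs (z - y))"
    using padic_abs_add_le_max[of "x - z" "z - y"] by simp
  also have "padic_abs (z - y) = padic_abs (y - z)"
    using padic_abs_uminus[of "y - z"] by simp
  also have "max (padic_abs (x - z)) (padic_abs (y - z)) \<le> padic_abs (x - z) + padic_abs (y - z)"
    by simp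
  finally show "dist x y \<le> dist x z + dist y z" by (simp add: dist_padic_def)
qed (simp_all add: uniformity_padic_def open_padic_def)

end

section \<open>Iteration of a map with a pole\<close>

text \<open>
  A rational function with pole \<open>s\<close> is totalised by \<open>x / 0 = 0\<close>.  Its \<open>n\<close>-th iterate is regarded as
  defined at \<open>x\<close> only if none of the points to which the function gets applied is \<open>s\<close>.
\<close>

definition iterate_defined :: "('a \<Rightarrow> 'a) \<Rightarrow> 'a \<Rightarrow> nat \<Rightarrow> 'a \<Rightarrow> bool" where
  "iterate_defined f s n x \<longleftrightarrow> (\<forall>m<n. (f ^^ m) x \<noteq> s)"

definition iterate_preimage :: "('a \<Rightarrow> 'a) \<Rightarrow> 'a \<Rightarrow> nat \<Rightarrow> 'a \<Rightarrow> 'a set" where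
  "iterate_preimage f s n a = {x. iterate_defined f s n x \<and> (f ^^ n) x = a}"

definition basin :: "('a::topological_space \<Rightarrow> 'a) \<Rightarrow> 'a \<Rightarrow> 'a \<Rightarrow> 'a set" where
  "basin f s a = {y. (\<forall>n. iterate_defined f s n y) \<and> (\<lambda>n. (f ^^ n) y) \<longlonglongrightarrow> a}"

end

theory Submission
  imports Defs
begin

text \<open>
  Put $T = |\theta|_p > 1$. The map is the square of the Moebius map
  $g(x) = (\theta x + q)/(x + \theta + q - 1)$, whose determinant $(\theta - 1)(\theta + q)$ has absolute
  value $T^2$; hence $|g(x) - g(y)|$ is known exactly once the absolute values of the two denominators
  are. The ultrametric inequality shows that the regions $|x| < 1$, $|x| = 1$ and $|x| > 1$ (without the
  pole) are each invariant. On $|x| < 1$ the denominators have absolute value $T$, so $g$ is an isometry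
  and squaring makes $f$ a contraction towards $x_2$. For $1 < |x| < T$ one has $|f(x)| = |x|^2$,
  so every orbit that avoids the pole eventually satisfies $|x| \ge T$, and then $|x| \ge T^2$, where $f$
  contracts by the factor $1/T$ towards $x_1$.
\<close>

section \<open>Preliminaries: contracting iterations and ultrametric sizes\<close>

lemma iterates_contraction_tendsto:
  fixes f :: "'a::metric_space \<Rightarrow> 'a"
  assumes "x \<in> S" "\<And>y. y \<in> S \<Longrightarrow> f y \<in> S"
    and contr: "\<And>y. y \<in> S \<Longrightarrow> dist (f y) a \<le> r * dist y a"
    and r: "0 \<le> r" "r < 1"
  shows "(\<lambda>n. (f ^^ n) x) \<longlonglongrightarrow> a"
proof -
  have S: "(f ^^ n) x \<in> S" for n
    by (induction n) (use assms in auto)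
  \<comment> \<open>The limit is prescribed, so only distances to \<open>a\<close> have to shrink,
    and they do so geometrically.\<close>
  have le: "dist ((f ^^ n) x) a \<le> r ^ n * dist x a" for n
  proof (induction n)
    case (Suc n)
    have "dist ((f ^^ Suc n) x) a \<le> r * dist ((f ^^ n) x) a"
      using contr[OF S] by simp
    also have "\<dots> \<le> r * (r ^ n * dist x a)"
      by (intro mult_left_mono Suc r)
    finally show ?case by (simp add: mult.assoc)
  qed simp
  have "(\<lambda>n. r ^ n * dist x a) \<longlonglongrightarrow> 0"
    using tendsto_mult_right[OF LIMSEQ_realpow_zero[OF r], of "dist x a"] by simp
  hence "(\<lambda>n. dist ((f ^^ n) x) a) \<longlonglongrightarrow> 0"
    by (rule tendsto_sandwich[of "\<lambda>_. 0", rotated 3]) (use le in auto)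
  thus ?thesis by (rule tendsto_dist_iff[THEN iffD2])
qed

lemma padic_abs_power: "padic_abs (x ^ n) = padic_abs x ^ n"
  by (induction n) (auto simp: padic_abs_mult)

lemma padic_abs_divide: "padic_abs (x / y) = padic_abs x / padic_abs y"
  by (simp add: divide_inverse padic_abs_mult padic_abs_inverse)

text \<open>Writing \<open>y\<close> as \<open>(x + y) + (- x)\<close> bounds its size by the larger
  of those of \<open>x + y\<close> and \<open>x\<close>; the latter is too small.\<close>

lemma padic_abs_add_eq_right:
  assumes "padic_abs x < padic_abs y"
  shows "padic_abs (x + y) = padic_abs y"
  using padic_abs_add_le_max[of x y] padic_abs_add_le_max[of "x + y" "- x"] assms by simp

lemma padic_abs_of_int_le_1: "padic_abs (of_int k) \<le> 1"
proof -
  have nat: "padic_abs (of_nat n :: 'a padic) \<le> 1" for n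
  proof (induction n)
    case (Suc n)
    thus ?case using padic_abs_add_le_max[of "1 :: 'a padic" "of_nat n"] by simp
  qed simp
  show ?thesis
  proof (cases k rule: int_cases2)
    case (nonneg n)
    with nat[of n] show ?thesis by simp
  next
    case (nonpos n)
    with nat[of n] show ?thesis by simp
  qed
qed

lemma padic_abs_CARD_powi_gt_1:
  assumes "N < 0"
  shows "padic_abs (of_nat CARD('p) powi N :: 'p::prime_card padic) > 1"
proof -
  have "real CARD('p) > 1"
    using prime_gt_1_nat[OF prime_CARD[where 'p = 'p]] by simp
  hence "real CARD('p) ^ nat (- N) > 1"
    using assms by (intro one_less_power) auto
  thus ?thesis
    using assms by (simp add: power_int_def padic_abs_power padic_abs_inverse padic_abs_CARD)
qed

section \<open>Sizes of the Moebius map and its denominator\<close>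

locale padic_square_map =
  fixes \<theta> q :: "'p::prime_card padic" and f :: "'p padic \<Rightarrow> 'p padic"
  assumes theta: "padic_abs \<theta> > 1" and q: "padic_abs q \<le> 1"
    and f: "f = (\<lambda>x. ((\<theta> * x + q) / (x + \<theta> + q - 1))\<^sup>2)"
begin

abbreviation T :: real where "T \<equiv> padic_abs \<theta>"
abbreviation pole :: "'p padic" where "pole \<equiv> 1 - \<theta> - q"
definition g :: "'p padic \<Rightarrow> 'p padic" where "g x = (\<theta> * x + q) / (x + \<theta> + q - 1)"

lemma theta_nonzero [simp]: "\<theta> \<noteq> 0"
  using theta by auto

lemma f_eq: "f x = (g x)\<^sup>2"
  by (simp add: f g_def)

lemma abs_f: "padic_abs (f x) = (padic_abs (g x))\<^sup>2"
  by (simp add: f_eq padic_abs_power)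

lemma abs_q_minus_1: "padic_abs (q - 1) \<le> 1"
  using padic_abs_add_le_max[of q "-1"] q by simp

lemma abs_pole: "padic_abs pole = T"
proof -
  have "padic_abs pole = padic_abs (- pole)" by (simp only: padic_abs_uminus)
  also have "- pole = (q - 1) + \<theta>" by simp
  also have "padic_abs \<dots> = T"
    using abs_q_minus_1 theta by (intro padic_abs_add_eq_right) simp
  finally show ?thesis .
qed

text \<open>The denominator is \<open>x - pole\<close> and \<open>pole\<close> has size
  \<open>T\<close>, so the strictly larger of the two terms decides.\<close>

lemma abs_denom_small:
  assumes "padic_abs x < T"
  shows "padic_abs (x + \<theta> + q - 1) = T"
  using padic_abs_add_eq_right[of x "- pole"] assms
  by (simp only: padic_abs_uminus abs_pole) (simp add: algebra_simps)

lemma abs_denom_large: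
  assumes "padic_abs x > T"
  shows "padic_abs (x + \<theta> + q - 1) = padic_abs x"
  using padic_abs_add_eq_right[of "- pole" x] assms
  by (simp only: padic_abs_uminus abs_pole) (simp add: algebra_simps)

lemma abs_denom_le: "padic_abs (x + \<theta> + q - 1) \<le> max (padic_abs x) T"
  using padic_abs_add_le_max[of x "- pole"]
  by (simp only: padic_abs_uminus abs_pole) (simp add: algebra_simps)

lemma denom_eq_0_iff: "x + \<theta> + q - 1 = 0 \<longleftrightarrow> x = pole"
  by (auto simp: algebra_simps add_eq_0_iff2)

lemma abs_numer:
  assumes "padic_abs x \<ge> 1"
  shows "padic_abs (\<theta> * x + q) = T * padic_abs x"
proof -
  have "1 * 1 < T * padic_abs x"
    using theta assms by (intro mult_less_le_imp_less) auto
  hence "padic_abs q < padic_abs (\<theta> * x)"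
    using q by (simp add: padic_abs_mult)
  from padic_abs_add_eq_right[OF this] show ?thesis
    by (simp add: padic_abs_mult add.commute)
qed

text \<open>The two terms of the numerator have sizes \<open>T * padic_abs x\<close> and at most 1,
  while the denominator has size exactly \<open>T\<close>.\<close>

lemma abs_g_unit_ball:
  assumes "padic_abs x < 1"
  shows "padic_abs (g x) \<le> max (padic_abs x) (1 / T)"
proof -
  have "padic_abs (\<theta> * x + q) \<le> max (T * padic_abs x) 1"
    using padic_abs_add_le_max[of "\<theta> * x" q] q by (simp add: padic_abs_mult)
  also have "\<dots> = max (padic_abs x) (1 / T) * T"
    using theta by (simp add: max_mult_distrib_right) (simp add: mult.commute)
  finally show ?thesis
    using assms theta abs_denom_small[of x] by (simp add: g_def padic_abs_divide divide_le_eq)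
qed

lemma abs_g_middle:
  assumes "padic_abs x \<ge> 1" "padic_abs x < T"
  shows "padic_abs (g x) = padic_abs x"
  using assms theta by (simp add: g_def padic_abs_divide abs_denom_small abs_numer)

lemma abs_g_far:
  assumes "padic_abs x > T"
  shows "padic_abs (g x) = T"
  using assms theta by (auto simp: g_def padic_abs_divide abs_denom_large abs_numer)

text \<open>On this sphere \<open>x\<close> and \<open>\<theta>\<close> may cancel, so the
  denominator is only bounded above, by \<open>T\<close>; the numerator has size
  \<open>T * T\<close>.\<close>

lemma abs_g_at_T:
  assumes "padic_abs x = T" "x \<noteq> pole"
  shows "padic_abs (g x) \<ge> T"
proof -
  have "padic_abs (x + \<theta> + q - 1) > 0"
    using assms(2) padic_abs_eq_0[of "x + \<theta> + q - 1"] padic_abs_nonneg[of "x + \<theta> + q - 1"]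
    unfolding denom_eq_0_iff by linarith
  thus ?thesis
    using assms theta abs_denom_le[of x] abs_numer[of x]
    by (simp add: g_def padic_abs_divide le_divide_eq)
qed

section \<open>Distances under the Moebius map and its square\<close>

lemma abs_g_diff:
  assumes "x \<noteq> pole" "y \<noteq> pole"
  shows "padic_abs (g x - g y) =
    T\<^sup>2 * padic_abs (x - y) / (padic_abs (x + \<theta> + q - 1) * padic_abs (y + \<theta> + q - 1))"
proof -
  have nz: "x + \<theta> + q - 1 \<noteq> 0" "y + \<theta> + q - 1 \<noteq> 0"
    using assms by (simp_all only: denom_eq_0_iff not_False_eq_True)
  \<comment> \<open>The determinant \<open>\<theta> * (\<theta> + q - 1) - q\<close> factors as
    \<open>(\<theta> - 1) * (\<theta> + q)\<close>.\<close>
  have 1: "g x - g y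
      = (\<theta> - 1) * (\<theta> + q) * (x - y) / ((x + \<theta> + q - 1) * (y + \<theta> + q - 1))"
    unfolding g_def diff_frac_eq[OF nz] by (simp add: algebra_simps)
  have 2: "padic_abs (\<theta> - 1) = T"
    using padic_abs_add_eq_right[of "-1" \<theta>] theta by simp
  have 3: "padic_abs (\<theta> + q) = T"
    using padic_abs_add_eq_right[of q \<theta>] theta q by (simp add: add.commute)
  show ?thesis
    unfolding 1 by (simp add: padic_abs_mult padic_abs_divide 2 3 power2_eq_square)
qed

lemma abs_f_diff: "padic_abs (f x - f y) = padic_abs (g x - g y) * padic_abs (g x + g y)"
proof -
  have "f x - f y = (g x - g y) * (g x + g y)"
    by (simp add: f_eq power2_eq_square algebra_simps)
  thus ?thesis by (simp add: padic_abs_mult)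
qed

text \<open>Here \<open>g\<close> preserves distances, and the factor \<open>g x + g y\<close> of
  the difference of squares supplies the contraction.\<close>

lemma abs_f_diff_unit_ball:
  assumes "padic_abs x < 1" "padic_abs y < 1"
  shows "padic_abs (f x - f y) \<le> padic_abs (x - y) * max (max (padic_abs x) (padic_abs y)) (1 / T)"
proof -
  have ne: "x \<noteq> pole" "y \<noteq> pole" using assms abs_pole theta by auto
  have "padic_abs (g x - g y) = padic_abs (x - y)"
    using abs_g_diff[OF ne] assms theta by (simp add: abs_denom_small power2_eq_square)
  moreover have "padic_abs (g x + g y) \<le> max (max (padic_abs x) (padic_abs y)) (1 / T)"
    using padic_abs_add_le_max[of "g x" "g y"] abs_g_unit_ball[OF assms(1)] abs_g_unit_ball[OF assms(2)]
    by linarith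
  ultimately show ?thesis
    by (simp add: abs_f_diff mult_left_mono)
qed

lemma T_less_square: "T < T\<^sup>2"
  using theta by (simp add: power2_eq_square)

text \<open>\<open>g\<close> shrinks distances by at least \<open>T\<^sup>2\<close>, and the factor
  \<open>g x + g y\<close> gives back at most \<open>T\<close>.\<close>

lemma abs_f_diff_far:
  assumes "padic_abs x \<ge> T\<^sup>2" "padic_abs y \<ge> T\<^sup>2"
  shows "padic_abs (f x - f y) \<le> (1 / T) * padic_abs (x - y)"
proof -
  have far: "padic_abs x > T" "padic_abs y > T" using assms T_less_square by auto
  have ne: "x \<noteq> pole" "y \<noteq> pole" using far abs_pole by auto
  have prod: "T\<^sup>2 * T\<^sup>2 \<le> padic_abs x * padic_abs y"
    using assms by (intro mult_mono) auto
  have pos: "T\<^sup>2 * T\<^sup>2 > 0" using theta by simp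
  have "padic_abs (g x - g y) = T\<^sup>2 * padic_abs (x - y) / (padic_abs x * padic_abs y)"
    using abs_g_diff[OF ne] far by (simp add: abs_denom_large)
  also have "\<dots> \<le> T\<^sup>2 * padic_abs (x - y) / (T\<^sup>2 * T\<^sup>2)"
    using prod mult_pos_pos[OF less_le_trans[OF pos prod] pos]
    by (intro divide_left_mono) simp_all
  also have "\<dots> = padic_abs (x - y) / T\<^sup>2"
    by (simp add: power2_eq_square)
  finally have "padic_abs (g x - g y) \<le> padic_abs (x - y) / T\<^sup>2" .
  moreover have "padic_abs (g x + g y) \<le> T"
    using padic_abs_add_le_max[of "g x" "g y"] far by (simp add: abs_g_far)
  ultimately have "padic_abs (f x - f y) \<le> padic_abs (x - y) / T\<^sup>2 * T"
    unfolding abs_f_diff by (intro mult_mono) auto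
  thus ?thesis by (simp add: power2_eq_square)
qed

section \<open>Fixed points and invariant regions\<close>

lemma fixed_point:
  assumes "x\<^sup>2 + (2 * \<theta> - \<theta>\<^sup>2 + 2 * q - 1) * x + q\<^sup>2 = 0" "x \<noteq> pole"
  shows "f x = x"
proof -
  have "x + \<theta> + q - 1 \<noteq> 0" using assms(2) by (simp only: denom_eq_0_iff not_False_eq_True)
  \<comment> \<open>Clearing the denominator in \<open>f x = x\<close> gives a cubic; splitting off
    the fixed point 1 leaves the quadratic.\<close>
  moreover have "x * (x + \<theta> + q - 1)\<^sup>2 - (\<theta> * x + q)\<^sup>2
      = (x - 1) * (x\<^sup>2 + (2 * \<theta> - \<theta>\<^sup>2 + 2 * q - 1) * x + q\<^sup>2)"
    by (simp add: power2_eq_square algebra_simps)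
  hence "(\<theta> * x + q)\<^sup>2 = x * (x + \<theta> + q - 1)\<^sup>2"
    using assms(1) by simp
  ultimately show ?thesis by (simp add: f power_divide)
qed

text \<open>\<open>g\<close> keeps this closed ball and squaring cannot leave it as
  \<open>r < 1\<close>. A fixed radius below 1 gives a uniform contraction factor along an
  orbit.\<close>

lemma abs_f_unit_ball:
  assumes "padic_abs x \<le> r" "1 / T \<le> r" "r < 1"
  shows "padic_abs (f x) \<le> r"
proof -
  have "padic_abs (g x) \<le> r" using abs_g_unit_ball[of x] assms by simp
  hence "(padic_abs (g x))\<^sup>2 \<le> r\<^sup>2" by (intro power_mono) auto
  also have "r\<^sup>2 \<le> r"
    using assms order_trans[OF padic_abs_nonneg assms(1)]
    by (simp add: power2_eq_square mult_left_le)
  finally show ?thesis by (simp add: abs_f)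
qed

lemma abs_f_lt_1:
  assumes "padic_abs x < 1"
  shows "padic_abs (f x) < 1"
proof -
  have "max (padic_abs x) (1 / T) < 1" using assms theta by simp
  with abs_f_unit_ball[of x "max (padic_abs x) (1 / T)"] show ?thesis by linarith
qed

lemma abs_f_eq_1: "padic_abs x = 1 \<Longrightarrow> padic_abs (f x) = 1"
  using abs_g_middle[of x] theta by (simp add: abs_f)

lemma abs_f_gt_1:
  assumes "padic_abs x > 1" "x \<noteq> pole"
  shows "padic_abs (f x) > 1"
proof -
  \<comment> \<open>The cases are size below, equal to and above \<open>T\<close>.\<close>
  have "padic_abs (g x) > 1"
    using abs_g_middle[of x] abs_g_at_T[of x] abs_g_far[of x] assms theta by fastforce
  thus ?thesis by (simp add: abs_f one_less_power)
qed

lemma abs_f_ge_T: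
  assumes "padic_abs x \<ge> T" "x \<noteq> pole"
  shows "padic_abs (f x) \<ge> T\<^sup>2"
proof -
  have "padic_abs (g x) \<ge> T"
    using abs_g_at_T[of x] abs_g_far[of x] assms by fastforce
  thus ?thesis unfolding abs_f by (intro power_mono) auto
qed

lemma iterates_lt_1: "padic_abs x < 1 \<Longrightarrow> padic_abs ((f ^^ n) x) < 1"
  by (induction n) (auto intro: abs_f_lt_1)

lemma iterates_eq_1: "padic_abs x = 1 \<Longrightarrow> padic_abs ((f ^^ n) x) = 1"
  by (induction n) (auto intro: abs_f_eq_1)

lemma iterates_gt_1:
  assumes "padic_abs x > 1" "\<And>n. (f ^^ n) x \<noteq> pole"
  shows "padic_abs ((f ^^ n) x) > 1"
  by (induction n) (simp_all add: abs_f_gt_1 assms)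

section \<open>Basins of attraction\<close>

lemma iterates_near_limit:
  assumes "(\<lambda>n. (f ^^ n) x) \<longlonglongrightarrow> a"
  obtains n where "padic_abs ((f ^^ n) x - a) < 1"
proof -
  \<comment> \<open>Radius 1 suffices: if \<open>a\<close> is off the unit sphere, points this close
    to \<open>a\<close> lie on the same side of it.\<close>
  have "eventually (\<lambda>n. dist ((f ^^ n) x) a < 1) sequentially"
    using assms by (rule tendstoD) simp
  thus ?thesis using that by (auto simp: eventually_sequentially dist_padic_def)
qed

lemma basin_iff:
  "x \<in> basin f pole a \<longleftrightarrow> (\<forall>n. (f ^^ n) x \<noteq> pole) \<and> (\<lambda>n. (f ^^ n) x) \<longlonglongrightarrow> a"
  unfolding basin_def iterate_defined_def by auto

lemma basin_small:
  assumes a: "padic_abs a < 1" "f a = a"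
  shows "basin f pole a = {x. padic_abs x < 1}"
proof (intro equalityI subsetI CollectI)
  fix x assume x: "x \<in> basin f pole a"
  then obtain n where "padic_abs ((f ^^ n) x - a) < 1"
    using iterates_near_limit unfolding basin_iff by blast
  hence "padic_abs ((f ^^ n) x) < 1"
    using padic_abs_add_le_max[of "(f ^^ n) x - a" a] a by simp
  \<comment> \<open>An orbit starting on the unit sphere or outside it would have stayed
    there.\<close>
  thus "padic_abs x < 1"
    using iterates_eq_1[of x n] iterates_gt_1[of x n] x unfolding basin_iff by force
next
  fix x :: "'p padic" assume "x \<in> {x. padic_abs x < 1}"
  hence x: "padic_abs x < 1" by simp
  \<comment> \<open>This ball contains \<open>x\<close> and \<open>a\<close>, is invariant because
    \<open>r\<close> is at least \<open>1 / T\<close>, and has \<open>r\<close> as contraction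
    factor.\<close>
  define r where "r = max (max (padic_abs x) (padic_abs a)) (1 / T)"
  have r: "padic_abs x \<le> r" "padic_abs a \<le> r" "1 / T \<le> r" "r < 1"
    using x a theta by (auto simp: r_def)
  have "(\<lambda>n. (f ^^ n) x) \<longlonglongrightarrow> a"
  proof (rule iterates_contraction_tendsto[where S = "{y. padic_abs y \<le> r}"])
    fix y :: "'p padic" assume "y \<in> {y. padic_abs y \<le> r}"
    hence y: "padic_abs y \<le> r" by simp
    show "f y \<in> {y. padic_abs y \<le> r}"
      using abs_f_unit_ball[OF y] r by simp
    have "padic_abs (f y - f a) \<le> padic_abs (y - a) * max (max (padic_abs y) (padic_abs a)) (1 / T)"
      using y r by (intro abs_f_diff_unit_ball) auto
    also have "\<dots> \<le> padic_abs (y - a) * r"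
      using y r by (intro mult_left_mono) auto
    finally show "dist (f y) a \<le> r * dist y a"
      by (simp add: dist_padic_def a mult.commute)
  qed (use r order_trans[OF padic_abs_nonneg r(1)] in auto)
  moreover have "(f ^^ n) x \<noteq> pole" for n
    using iterates_lt_1[OF x, of n] abs_pole theta by auto
  ultimately show "x \<in> basin f pole a" unfolding basin_iff by blast
qed

lemma iterates_escape:
  assumes x: "padic_abs x > 1"
  obtains n where "padic_abs ((f ^^ n) x) \<ge> T"
proof (rule ccontr)
  assume "\<not> thesis"
  with that have lt: "padic_abs ((f ^^ n) x) < T" for n by (meson not_less)
  \<comment> \<open>Below \<open>T\<close> each step squares the size. The true exponent is
    \<open>2 ^ n\<close>, but \<open>Suc n\<close> already gives unbounded growth.\<close>
  have ge: "padic_abs ((f ^^ n) x) \<ge> padic_abs x ^ Suc n" for n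
  proof (induction n)
    case (Suc n)
    let ?y = "padic_abs ((f ^^ n) x)"
    have "padic_abs x ^ Suc (Suc n) \<le> (padic_abs x ^ Suc n)\<^sup>2"
      unfolding power_mult[symmetric] using x by (intro power_increasing) auto
    also have "\<dots> \<le> ?y\<^sup>2" using Suc by (intro power_mono) auto
    also have "?y \<ge> 1" using one_le_power[of "padic_abs x" "Suc n"] x Suc by linarith
    hence "?y\<^sup>2 = padic_abs ((f ^^ Suc n) x)"
      using abs_g_middle lt by (simp add: abs_f)
    finally show ?case .
  qed simp
  obtain n where "T < padic_abs x ^ n" using real_arch_pow[OF x] by blast
  also have "\<dots> \<le> padic_abs x ^ Suc n" using x by (intro power_increasing) auto
  finally show False using ge[of n] lt[of n] by linarith
qed

lemma basin_large:
  assumes a: "padic_abs a \<ge> T\<^sup>2" "f a = a"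
  shows "basin f pole a = {x. padic_abs x > 1} - (\<Union>n. iterate_preimage f pole n pole)"
proof (intro equalityI subsetI)
  fix x assume x: "x \<in> basin f pole a"
  then obtain n where "padic_abs ((f ^^ n) x - a) < 1"
    using iterates_near_limit unfolding basin_iff by blast
  hence "padic_abs ((f ^^ n) x) > 1"
    using padic_abs_add_eq_right[of "(f ^^ n) x - a" a] a theta T_less_square by simp
  hence "padic_abs x > 1"
    using iterates_eq_1[of x n] iterates_lt_1[of x n] by force
  thus "x \<in> {x. padic_abs x > 1} - (\<Union>n. iterate_preimage f pole n pole)"
    using x unfolding basin_iff iterate_preimage_def by blast
next
  fix x :: "'p padic" assume x: "x \<in> {x. padic_abs x > 1} - (\<Union>n. iterate_preimage f pole n pole)"
  \<comment> \<open>Membership in the \<open>n\<close>-th preimage also demands that all earlier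
    iterates avoid the pole, hence strong induction.\<close>
  have np: "(f ^^ n) x \<noteq> pole" for n
  proof (induction n rule: less_induct)
    case (less n)
    thus ?case using x by (auto simp: iterate_preimage_def iterate_defined_def)
  qed
  obtain n where "padic_abs ((f ^^ n) x) \<ge> T"
    using iterates_escape x by blast
  \<comment> \<open>One further step leads from size \<open>T\<close> to \<open>T\<^sup>2\<close>,
    where \<open>f\<close> contracts; the initial segment of the orbit is dropped and restored by an
    index shift.\<close>
  hence far: "padic_abs ((f ^^ Suc n) x) \<ge> T\<^sup>2"
    using abs_f_ge_T np by simp
  have "(\<lambda>k. (f ^^ k) ((f ^^ Suc n) x)) \<longlonglongrightarrow> a"
  proof (rule iterates_contraction_tendsto[where S = "{y. padic_abs y \<ge> T\<^sup>2}" and r = "1 / T"])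
    fix y :: "'p padic" assume "y \<in> {y. padic_abs y \<ge> T\<^sup>2}"
    hence y: "padic_abs y \<ge> T\<^sup>2" by simp
    thus "f y \<in> {y. padic_abs y \<ge> T\<^sup>2}"
      using abs_f_ge_T[of y] abs_pole T_less_square by fastforce
    show "dist (f y) a \<le> 1 / T * dist y a"
      using abs_f_diff_far[OF y a(1)] a(2) by (simp add: dist_padic_def)
  qed (use far theta in auto)
  hence "(\<lambda>k. (f ^^ (k + Suc n)) x) \<longlonglongrightarrow> a"
    by (simp only: funpow_add o_apply)
  hence "(\<lambda>k. (f ^^ k) x) \<longlonglongrightarrow> a" by (rule LIMSEQ_offset)
  with np show "x \<in> basin f pole a" unfolding basin_iff by blast
qed

end

theorem theorem5p8:
  fixes q N :: int
    and \<theta> x1 x2 :: "'p::prime_card padic"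
    and f :: "'p padic \<Rightarrow> 'p padic"
  assumes p: "CARD('p) \<ge> 3"
    and q: "q \<ge> 1"
    and N: "N < 0"
    and \<theta>: "\<theta> = of_nat CARD('p) powi N"
    and f: "f = (\<lambda>x. ((\<theta> * x + of_int q) / (x + \<theta> + of_int q - 1))\<^sup>2)"
    and x1: "x1\<^sup>2 + (2 * \<theta> - \<theta>\<^sup>2 + 2 * of_int q - 1) * x1 + (of_int q)\<^sup>2 = 0"
      "padic_abs x1 = (padic_abs \<theta>)\<^sup>2"
    and x2: "x2\<^sup>2 + (2 * \<theta> - \<theta>\<^sup>2 + 2 * of_int q - 1) * x2 + (of_int q)\<^sup>2 = 0"
      "padic_abs x2 = (padic_abs (of_int q / \<theta>))\<^sup>2"
  shows "f ` {x. padic_abs x = 1} \<subseteq> {x. padic_abs x = 1}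
    \<and> basin f (1 - \<theta> - of_int q) x2 = {x. padic_abs x < 1}
    \<and> basin f (1 - \<theta> - of_int q) x1
        = {x. padic_abs x > 1}
          - (\<Union>n. iterate_preimage f (1 - \<theta> - of_int q) n (1 - \<theta> - of_int q))"
proof -
  \<comment> \<open>The locale needs only sizes: \<open>\<theta>\<close> has size above 1 and every
    integer has size at most 1.\<close>
  interpret padic_square_map \<theta> "of_int q" f
    using padic_abs_CARD_powi_gt_1[OF N] padic_abs_of_int_le_1 f by unfold_locales (auto simp: \<theta>)
  have big: "padic_abs x1 \<ge> T\<^sup>2"
    by (simp add: x1(2))
  have "padic_abs (of_int q / \<theta>) < 1"
    using theta q by (simp add: padic_abs_divide)
  hence small: "padic_abs x2 < 1"
    by (simp add: x2(2) power_less_one_iff)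
  \<comment> \<open>Neither root is the pole, whose size is \<open>T\<close>: \<open>x1\<close> has
    size \<open>T\<^sup>2\<close> and \<open>x2\<close> has size below 1.\<close>
  have "f x1 = x1"
    using fixed_point[OF x1(1)] big abs_pole T_less_square by force
  moreover have "f x2 = x2"
    using fixed_point[OF x2(1)] small abs_pole theta by force
  ultimately show ?thesis
    using basin_small[OF small] basin_large[OF big] abs_f_eq_1 by auto
qed

end
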